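(* Let $\mathcal{A}$ be an associative unital algebra over a field $\mathrm{k}$ of characteristic zero, and let $A$ be an infinite matrix with entries in $\mathcal{A}$. Then $A$ admits a periodic Gaussian elimination process if and only if $A$ admits an LU-decomposition. In fact, if $A=LU$ is an LU-decomposition, then $T_0=s(L)L^{-1}$ is a fundamental sequence of the Gaussian elimination process of $A$; conversely, if $T_0$ is a fundamental sequence of the Gaussian elimination process of $A$, then $A$ has an LU-decomposition $A=LU$ with $$L^{-1}=(T_0)^{\mathrm{L}}\quad\text{and}\quad L=(T_0^{-1})^{\mathrm{R}}.$$
   Context: Infinite matrices are indexed by $i,j\ge1$. An LU-decomposition of $A$ is a factorization $A=LU$ with $L$ lower triangular with $1$'s on the diagonal and $U$ upper triangular. For an infinite matrix $T$, the shifted matrix is $s(T)=\begin{pmatrix}1&0\\0&T\end{pmatrix}$ (with a $1\times1$ identity block). A sequence of infinite matrices $B_k$ converges to $B$ if for every $i,j$ there exists $k_0$ with $(B_k)_{ij}=B_{ij}$ for all $k\ge k_0$. For a lower triangular matrix $T_0$ with $1$'s on the diagonal, the left iterated matrix is the limit $T_0^{\mathrm{L}}=\cdots s^3(T_0)s^2(T_0)s(T_0)T_0$ and the right iterated matrix is the limit $T_0^{\mathrm{R}}=T_0\,s(T_0)s^2(T_0)s^3(T_0)\cdots$ (both limits exist and are lower triangular). $A$ admits a periodic Gaussian elimination process if there is a lower triangular matrix $T_0$ with $1$'s on the diagonal such that $T_0^{\mathrm{L}}A$ is upper triangular; such a $T_0$ is called a fundamental sequence of the Gaussian elimination process of $A$.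 *)

theory Defs
  imports Complex_Main "HOL-Library.Groups_Big_Fun"
begin

text \<open>
  Associative unital algebras over a field. The sort \<open>{ring, monoid_mult}\<close> is that of associative
  rings with unit; unlike \<open>ring_1\<close> it does not exclude the zero algebra.
\<close>

locale unital_algebra = vector_space scale
  for scale :: "'k::field \<Rightarrow> 'a::{ring, monoid_mult} \<Rightarrow> 'a" +
  assumes scale_mult_left: "scale c x * y = scale c (x * y)"
    and scale_mult_right: "x * scale c y = scale c (x * y)"

text \<open>
  Rows and columns are numbered from 0: the entry \<open>A i j\<close> is the one in row \<open>i + 1\<close> and
  column \<open>j + 1\<close> when they are numbered from 1.
\<close>

type_synonym 'a infmat = "nat \<Rightarrow> nat \<Rightarrow> 'a"

definition mat_one :: "'a::{zero, one} infmat" where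
  "mat_one = (\<lambda>i j. if i = j then 1 else 0)"

text \<open>
  \<open>Sum_any\<close> sums over the support of the summand and is 0 if the support is infinite. The support
  lies in \<open>{..i}\<close> whenever the left factor is lower triangular.
\<close>

definition mat_mult :: "'a::semiring_0 infmat \<Rightarrow> 'a infmat \<Rightarrow> 'a infmat" (infixl "\<odot>" 70) where
  "A \<odot> B = (\<lambda>i j. Sum_any (\<lambda>k. A i k * B k j))"

definition lower_unitriangular :: "'a::{zero, one} infmat \<Rightarrow> bool" where
  "lower_unitriangular L \<longleftrightarrow> (\<forall>i j. i < j \<longrightarrow> L i j = 0) \<and> (\<forall>i. L i i = 1)"

definition upper_triangular :: "'a::zero infmat \<Rightarrow> bool" where
  "upper_triangular U \<longleftrightarrow> (\<forall>i j. j < i \<longrightarrow> U i j = 0)"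

text \<open>
  A two-sided inverse of an infinite matrix need not be unique, but a lower unitriangular matrix
  has exactly one (which is again lower unitriangular); only such matrices are inverted below.
\<close>

definition mat_inv :: "'a::{semiring_0, one} infmat \<Rightarrow> 'a infmat" where
  "mat_inv A = (THE B. A \<odot> B = mat_one \<and> B \<odot> A = mat_one)"

fun shift :: "'a::{zero, one} infmat \<Rightarrow> 'a infmat" where
  "shift T 0 0 = 1"
| "shift T 0 (Suc j) = 0"
| "shift T (Suc i) 0 = 0"
| "shift T (Suc i) (Suc j) = T i j"

definition mat_converges :: "(nat \<Rightarrow> 'a infmat) \<Rightarrow> 'a infmat \<Rightarrow> bool" where
  "mat_converges B C \<longleftrightarrow> (\<forall>i j. \<exists>k0. \<forall>k\<ge>k0. B k i j = C i j)"

definition mat_lim :: "(nat \<Rightarrow> 'a infmat) \<Rightarrow> 'a infmat" where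
  "mat_lim B = (THE C. mat_converges B C)"

primrec left_partial :: "'a::{semiring_0, one} infmat \<Rightarrow> nat \<Rightarrow> 'a infmat" where
  "left_partial T 0 = T"
| "left_partial T (Suc n) = (shift ^^ Suc n) T \<odot> left_partial T n"

primrec right_partial :: "'a::{semiring_0, one} infmat \<Rightarrow> nat \<Rightarrow> 'a infmat" where
  "right_partial T 0 = T"
| "right_partial T (Suc n) = right_partial T n \<odot> (shift ^^ Suc n) T"

definition left_iterated :: "'a::{semiring_0, one} infmat \<Rightarrow> 'a infmat" where
  "left_iterated T = mat_lim (left_partial T)"

definition right_iterated :: "'a::{semiring_0, one} infmat \<Rightarrow> 'a infmat" where
  "right_iterated T = mat_lim (right_partial T)"

definition LU_decomposition :: "'a::{semiring_0, one} infmat \<Rightarrow> 'a infmat \<Rightarrow> 'a infmat \<Rightarrow> bool" where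
  "LU_decomposition A L U \<longleftrightarrow> lower_unitriangular L \<and> upper_triangular U \<and> A = L \<odot> U"

definition fundamental_sequence :: "'a::{semiring_0, one} infmat \<Rightarrow> 'a infmat \<Rightarrow> bool" where
  "fundamental_sequence A T \<longleftrightarrow>
     lower_unitriangular T \<and> upper_triangular (left_iterated T \<odot> A)"

definition admits_periodic_gauss :: "'a::{semiring_0, one} infmat \<Rightarrow> bool" where
  "admits_periodic_gauss A \<longleftrightarrow> (\<exists>T. fundamental_sequence A T)"

end

theory Submission imports Defs begin

text \<open>
  For \<open>T = s(L) L\<^sup>-\<^sup>1\<close> the product \<open>s\<^sup>n(T) \<cdots> s(T) T\<close> telescopes to \<open>s\<^sup>n\<^sup>+\<^sup>1(L) L\<^sup>-\<^sup>1\<close>, and the first \<open>n\<close>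
  rows of \<open>s\<^sup>n(L)\<close> are those of the identity, so the left iterated matrix is \<open>L\<^sup>-\<^sup>1\<close>. Conversely, for
  any \<open>T\<close> and for the same reason, row \<open>i\<close> (from 0) of the partial products is constant from step \<open>i\<close>
  on. The left partial products of \<open>T\<close> and the right ones of \<open>T\<^sup>-\<^sup>1\<close> are inverse to each other, hence
  so are the limits.
\<close>

section \<open>Products whose left factors are lower unitriangular\<close>

lemma mat_mult_lower:
  assumes "lower_unitriangular A"
  shows "(A \<odot> B) i j = (\<Sum>k\<le>i. A i k * B k j)"
proof -
  have "A i k * B k j = 0" if "i < k" for k
    using assms that by (simp add: lower_unitriangular_def)
  then have "{k. A i k * B k j \<noteq> 0} \<subseteq> {..i}"
    by (auto simp: not_less[symmetric])
  then show ?thesis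
    unfolding mat_mult_def by (rule Sum_any.expand_superset[OF finite_atMost])
qed

lemma lower_unitriangular_mat_one: "lower_unitriangular mat_one"
  by (simp add: lower_unitriangular_def mat_one_def)

lemma mat_one_mult: "mat_one \<odot> A = (A :: 'a::{ring, monoid_mult} infmat)"
  by (simp add: fun_eq_iff mat_mult_lower[OF lower_unitriangular_mat_one])
     (simp add: mat_one_def if_distrib[of "\<lambda>x. x * _"] cong: if_cong)

lemma mat_mult_one:
  fixes A :: "'a::{ring, monoid_mult} infmat"
  assumes "lower_unitriangular A"
  shows "A \<odot> mat_one = A"
  using assms
  by (auto simp: fun_eq_iff mat_mult_lower mat_one_def if_distrib[of "\<lambda>x. _ * x"]
      lower_unitriangular_def cong: if_cong)

lemma lower_unitriangular_mult:
  fixes A B :: "'a::{ring, monoid_mult} infmat"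
  assumes A: "lower_unitriangular A" and B: "lower_unitriangular B"
  shows "lower_unitriangular (A \<odot> B)"
proof -
  have "(\<Sum>k\<le>i. A i k * B k i) = (\<Sum>k\<le>i. if k = i then 1 else 0)" for i
    using A B by (intro sum.cong) (auto simp: lower_unitriangular_def)
  moreover have "(\<Sum>k\<le>i. A i k * B k j) = 0" if "i < j" for i j
    using that B by (intro sum.neutral) (auto simp: lower_unitriangular_def)
  ultimately show ?thesis
    by (simp add: lower_unitriangular_def mat_mult_lower[OF A])
qed

text \<open>Products of infinite matrices are not associative in general. Triangularity of the two
  left factors makes every sum finite, so \<open>C\<close> may be arbitrary, as it must be when it
  is \<open>A\<close> or \<open>U\<close>.\<close>

lemma mat_mult_assoc:
  fixes A B C :: "'a::{ring, monoid_mult} infmat"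
  assumes A: "lower_unitriangular A" and B: "lower_unitriangular B"
  shows "(A \<odot> B) \<odot> C = A \<odot> (B \<odot> C)"
proof (intro ext)
  fix i j
  \<comment> \<open>Padding with the zero entries of \<open>B\<close> gives a summation range
    independent of \<open>k\<close>, so that the two sums can be swapped.\<close>
  have inner: "(B \<odot> C) k j = (\<Sum>l\<le>i. B k l * C l j)" if "k \<le> i" for k
    unfolding mat_mult_lower[OF B] using that B
    by (intro sum.mono_neutral_left) (auto simp: lower_unitriangular_def)
  have "((A \<odot> B) \<odot> C) i j = (\<Sum>l\<le>i. \<Sum>k\<le>i. A i k * B k l * C l j)"
    by (simp add: mat_mult_lower[OF lower_unitriangular_mult[OF A B]] mat_mult_lower[OF A]
        sum_distrib_right)
  also have "\<dots> = (\<Sum>k\<le>i. \<Sum>l\<le>i. A i k * (B k l * C l j))"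
    by (subst sum.swap) (simp add: mult.assoc)
  also have "\<dots> = (A \<odot> (B \<odot> C)) i j"
    by (simp add: mat_mult_lower[OF A] inner sum_distrib_left)
  finally show "((A \<odot> B) \<odot> C) i j = (A \<odot> (B \<odot> C)) i j" .
qed

section \<open>Inverses by forward substitution\<close>

fun forward_substitution :: "'a::{ring, monoid_mult} infmat \<Rightarrow> 'a infmat" where
  "forward_substitution A i j = mat_one i j - (\<Sum>k<i. A i k * forward_substitution A k j)"

text \<open>The recursion equation has no guard and would unfold forever as a simp rule.\<close>

declare forward_substitution.simps [simp del]

lemma lower_unitriangular_forward_substitution:
  "lower_unitriangular (forward_substitution A)"
proof -
  have upper: "forward_substitution A i j = 0" if "i < j" for i j
    using that
  proof (induction i rule: less_induct)
    case (less i)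
    then show ?case
      by (simp add: forward_substitution.simps[of A i] mat_one_def)
  qed
  then show ?thesis
    by (simp add: lower_unitriangular_def forward_substitution.simps[of A i i for i] mat_one_def)
qed

text \<open>The diagonal entry 1 isolates the term \<open>k = i\<close> of the sum, and the
  recursion defines that term as \<open>mat_one i j\<close> minus all the others.\<close>

lemma mult_forward_substitution:
  assumes "lower_unitriangular A"
  shows "A \<odot> forward_substitution A = mat_one"
proof (intro ext)
  fix i j
  have "(A \<odot> forward_substitution A) i j
      = (\<Sum>k<i. A i k * forward_substitution A k j) + forward_substitution A i j"
    using assms
    by (simp add: mat_mult_lower lower_unitriangular_def lessThan_Suc_atMost[symmetric])
  then show "(A \<odot> forward_substitution A) i j = mat_one i j"
    by (simp add: forward_substitution.simps[of A i])
qed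

text \<open>\<open>B\<close> has a right inverse \<open>C\<close> of its own, and a left and a right
  inverse of \<open>B\<close> coincide: A = A(BC) = (AB)C = C.\<close>

lemma lower_unitriangular_left_inverse:
  fixes A B :: "'a::{ring, monoid_mult} infmat"
  assumes A: "lower_unitriangular A" and B: "lower_unitriangular B" and AB: "A \<odot> B = mat_one"
  shows "B \<odot> A = mat_one"
proof -
  define C where "C = forward_substitution B"
  have BC: "B \<odot> C = mat_one"
    by (simp add: C_def B mult_forward_substitution)
  have "A = A \<odot> (B \<odot> C)"
    by (simp add: BC A mat_mult_one)
  also have "\<dots> = C"
    by (simp add: mat_mult_assoc[symmetric] A B AB mat_one_mult)
  finally show ?thesis
    using BC by simp
qed

lemma mat_inv_eqI:
  fixes A B :: "'a::{ring, monoid_mult} infmat"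
  assumes A: "lower_unitriangular A" and B: "lower_unitriangular B" and AB: "A \<odot> B = mat_one"
  shows "mat_inv A = B"
  unfolding mat_inv_def
proof (rule the_equality)
  have BA: "B \<odot> A = mat_one"
    using lower_unitriangular_left_inverse[OF A B AB] .
  then show "A \<odot> B = mat_one \<and> B \<odot> A = mat_one"
    using AB by simp
  \<comment> \<open>The competitor \<open>C\<close> need not be triangular: in C = (BA)C = B(AC) = B
    only the left factors \<open>B\<close> and \<open>A\<close> have to be.\<close>
  show "C = B" if "A \<odot> C = mat_one \<and> C \<odot> A = mat_one" for C
    using mat_mult_assoc[OF B A, of C] that by (simp add: BA mat_one_mult mat_mult_one[OF B])
qed

lemma
  fixes A :: "'a::{ring, monoid_mult} infmat"
  assumes A: "lower_unitriangular A"
  shows lower_unitriangular_mat_inv: "lower_unitriangular (mat_inv A)"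
    and mat_inv_right: "A \<odot> mat_inv A = mat_one"
    and mat_inv_left: "mat_inv A \<odot> A = mat_one"
proof -
  have eq: "mat_inv A = forward_substitution A"
    by (intro mat_inv_eqI A lower_unitriangular_forward_substitution mult_forward_substitution)
  show *: "lower_unitriangular (mat_inv A)" "A \<odot> mat_inv A = mat_one"
    by (simp_all add: eq lower_unitriangular_forward_substitution mult_forward_substitution A)
  show "mat_inv A \<odot> A = mat_one"
    by (rule lower_unitriangular_left_inverse[OF A *])
qed

section \<open>The shift and its powers\<close>

lemma lower_unitriangular_shift:
  assumes "lower_unitriangular T"
  shows "lower_unitriangular (shift T)"
proof -
  have "shift T i j = 0" if "i < j" for i j
    using that assms by (cases "(T, i, j)" rule: shift.cases) (auto simp: lower_unitriangular_def)
  moreover have "shift T i i = 1" for i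
    using assms by (cases i) (auto simp: lower_unitriangular_def)
  ultimately show ?thesis
    by (simp add: lower_unitriangular_def)
qed

lemma lower_unitriangular_shift_power:
  "lower_unitriangular T \<Longrightarrow> lower_unitriangular ((shift ^^ n) T)"
  by (induction n) (auto intro: lower_unitriangular_shift)

lemma shift_mat_one: "shift mat_one = mat_one"
proof (intro ext)
  show "shift mat_one i j = (mat_one i j :: 'a)" for i j
    by (cases i; cases j) (simp_all add: mat_one_def)
qed

lemma shift_mult:
  fixes A B :: "'a::{ring, monoid_mult} infmat"
  assumes A: "lower_unitriangular A"
  shows "shift (A \<odot> B) = shift A \<odot> shift B"
proof (intro ext)
  show "shift (A \<odot> B) i j = (shift A \<odot> shift B) i j" for i j
    \<comment> \<open>Splitting off the first summand \<open>k = 0\<close>, rather than the last,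
      separates the 1x1 block from the shifted one.\<close>
    by (cases i; cases j)
       (simp_all add: mat_mult_lower A lower_unitriangular_shift sum.atMost_Suc_shift
         del: sum.atMost_Suc)
qed

lemma shift_power_mat_one: "(shift ^^ n) mat_one = mat_one"
  by (induction n) (simp_all add: shift_mat_one)

lemma shift_power_mult:
  fixes A B :: "'a::{ring, monoid_mult} infmat"
  assumes "lower_unitriangular A"
  shows "(shift ^^ n) (A \<odot> B) = (shift ^^ n) A \<odot> (shift ^^ n) B"
  by (induction n) (simp_all add: shift_mult lower_unitriangular_shift_power assms)

lemma shift_power_row: "i < n \<Longrightarrow> (shift ^^ n) T i j = mat_one i j"
proof (induction n arbitrary: i j)
  case (Suc n)
  then show ?case
    by (cases i; cases j) (simp_all add: mat_one_def)
qed simp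

lemma shift_power_mult_row:
  fixes T B :: "'a::{ring, monoid_mult} infmat"
  assumes "lower_unitriangular T" "i < n"
  shows "((shift ^^ n) T \<odot> B) i j = B i j"
proof -
  have "((shift ^^ n) T \<odot> B) i j = (mat_one \<odot> B) i j"
    using assms by (simp add: mat_mult_lower lower_unitriangular_shift_power shift_power_row
        lower_unitriangular_mat_one)
  then show ?thesis
    by (simp add: mat_one_mult)
qed

text \<open>Row \<open>i\<close> of the product uses only the rows \<open>k \<le> i\<close> of the
  right factor, because \<open>B\<close> is lower triangular, and these are all identity
  rows.\<close>

lemma mult_shift_power_row:
  fixes T B :: "'a::{ring, monoid_mult} infmat"
  assumes "lower_unitriangular B" "i < n"
  shows "(B \<odot> (shift ^^ n) T) i j = B i j"
proof -
  have "(B \<odot> (shift ^^ n) T) i j = (B \<odot> mat_one) i j"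
    using assms by (simp add: mat_mult_lower shift_power_row)
  then show ?thesis
    by (simp add: mat_mult_one assms)
qed

section \<open>Limits of the partial products\<close>

lemma mat_lim_eqI:
  assumes "\<And>n i j. i \<le> n \<Longrightarrow> B n i j = C i j"
  shows "mat_lim B = C"
  unfolding mat_lim_def
proof (rule the_equality)
  show "mat_converges B C"
    using assms by (auto simp: mat_converges_def)
  show "D = C" if D: "mat_converges B D" for D
  proof (intro ext)
    fix i j
    obtain k0 where "\<forall>k\<ge>k0. B k i j = D i j"
      using D unfolding mat_converges_def by blast
    \<comment> \<open>Stage \<open>max k0 i\<close> is late enough both for convergence to
      \<open>D\<close> and for agreement with \<open>C\<close>.\<close>
    then have "B (max k0 i) i j = D i j"
      by simp
    then show "D i j = C i j"
      using assms[of i "max k0 i" j] by simp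
  qed
qed

lemma row_stationary:
  assumes "\<And>n i j. i \<le> n \<Longrightarrow> B (Suc n) i j = B n i j" and "i \<le> n"
  shows "B n i j = B i i j"
  using assms(2) by (induction rule: dec_induct) (simp_all add: assms(1))

lemma lower_unitriangular_left_partial:
  fixes T :: "'a::{ring, monoid_mult} infmat"
  shows "lower_unitriangular T \<Longrightarrow> lower_unitriangular (left_partial T n)"
  by (induction n)
     (simp_all add: lower_unitriangular_mult lower_unitriangular_shift
       lower_unitriangular_shift_power)

lemma lower_unitriangular_right_partial:
  fixes T :: "'a::{ring, monoid_mult} infmat"
  shows "lower_unitriangular T \<Longrightarrow> lower_unitriangular (right_partial T n)"
  by (induction n)
     (simp_all add: lower_unitriangular_mult lower_unitriangular_shift
       lower_unitriangular_shift_power)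

text \<open>The factor added in passing from stage \<open>n\<close> to \<open>n + 1\<close> is
  shifted \<open>n + 1\<close> times, so it leaves the rows \<open>i \<le> n\<close>
  unchanged.\<close>

lemma left_iterated_row:
  fixes T :: "'a::{ring, monoid_mult} infmat"
  assumes T: "lower_unitriangular T" and "i \<le> n"
  shows "left_partial T n i j = left_iterated T i j"
proof -
  have stat: "left_partial T n i j = left_partial T i i j" if "i \<le> n" for n i j
    \<comment> \<open>Without \<open>funpow.simps\<close> the power \<open>shift ^^ Suc n\<close>
      stays folded and matches the row lemma.\<close>
    by (rule row_stationary[OF _ that])
       (use T in \<open>simp add: shift_power_mult_row del: funpow.simps\<close>)
  have "left_iterated T = (\<lambda>i j. left_partial T i i j)"
    unfolding left_iterated_def by (intro mat_lim_eqI stat)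
  then show ?thesis
    using stat[OF assms(2)] by simp
qed

lemma right_iterated_row:
  fixes T :: "'a::{ring, monoid_mult} infmat"
  assumes T: "lower_unitriangular T" and "i \<le> n"
  shows "right_partial T n i j = right_iterated T i j"
proof -
  have stat: "right_partial T n i j = right_partial T i i j" if "i \<le> n" for n i j
    by (rule row_stationary[OF _ that])
       (use T in \<open>simp add: mult_shift_power_row lower_unitriangular_right_partial
          del: funpow.simps\<close>)
  have "right_iterated T = (\<lambda>i j. right_partial T i i j)"
    unfolding right_iterated_def by (intro mat_lim_eqI stat)
  then show ?thesis
    using stat[OF assms(2)] by simp
qed

lemma lower_unitriangular_left_iterated:
  fixes T :: "'a::{ring, monoid_mult} infmat"
  assumes T: "lower_unitriangular T"
  shows "lower_unitriangular (left_iterated T)"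
  using lower_unitriangular_left_partial[OF T]
  by (simp add: lower_unitriangular_def left_iterated_row[OF T order_refl, symmetric])

lemma lower_unitriangular_right_iterated:
  fixes T :: "'a::{ring, monoid_mult} infmat"
  assumes T: "lower_unitriangular T"
  shows "lower_unitriangular (right_iterated T)"
  using lower_unitriangular_right_partial[OF T]
  by (simp add: lower_unitriangular_def right_iterated_row[OF T order_refl, symmetric])

section \<open>Mutually inverse iterated matrices\<close>

lemma right_partial_mult_left_partial:
  fixes S T :: "'a::{ring, monoid_mult} infmat"
  assumes S: "lower_unitriangular S" and T: "lower_unitriangular T" and ST: "S \<odot> T = mat_one"
  shows "right_partial S n \<odot> left_partial T n = mat_one"
proof (induction n)
  case 0
  then show ?case
    using ST by simp
next
  case (Suc n)
  let ?S = "(shift ^^ Suc n) S" and ?T = "(shift ^^ Suc n) T"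
  note lower = lower_unitriangular_right_partial[OF S] lower_unitriangular_left_partial[OF T]
    lower_unitriangular_shift_power[OF S] lower_unitriangular_shift_power[OF T]
  have "?S \<odot> ?T = mat_one"
    unfolding shift_power_mult[OF S, symmetric] ST by (rule shift_power_mat_one)
  \<comment> \<open>The newest factors of the two products meet in the middle and cancel, leaving
    the product of stage \<open>n\<close>.\<close>
  then have "?S \<odot> (?T \<odot> left_partial T n) = left_partial T n"
    by (simp add: mat_mult_assoc[symmetric] lower mat_one_mult del: funpow.simps)
  then show ?case
    using Suc by (simp add: mat_mult_assoc lower lower_unitriangular_mult del: funpow.simps)
qed

lemma right_iterated_mult_left_iterated:
  fixes S T :: "'a::{ring, monoid_mult} infmat"
  assumes S: "lower_unitriangular S" and T: "lower_unitriangular T" and ST: "S \<odot> T = mat_one"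
  shows "right_iterated S \<odot> left_iterated T = mat_one"
proof (intro ext)
  fix i j
  \<comment> \<open>Stage \<open>i\<close> has already reached the limit in row \<open>i\<close> of
    the right product and in all rows \<open>k \<le> i\<close> of the left one.\<close>
  have "(\<Sum>k\<le>i. right_iterated S i k * left_iterated T k j)
      = (\<Sum>k\<le>i. right_partial S i i k * left_partial T i k j)"
    by (rule sum.cong) (simp_all add: right_iterated_row left_iterated_row S T)
  then have "(right_iterated S \<odot> left_iterated T) i j = (right_partial S i \<odot> left_partial T i) i j"
    by (simp only: mat_mult_lower lower_unitriangular_right_iterated
        lower_unitriangular_right_partial S)
  then show "(right_iterated S \<odot> left_iterated T) i j = mat_one i j"
    by (simp add: right_partial_mult_left_partial assms)
qed

section \<open>Telescoping for the fundamental sequence of a given L\<close>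

lemma left_partial_shift_mult_inverse:
  fixes L M :: "'a::{ring, monoid_mult} infmat"
  assumes L: "lower_unitriangular L" and M: "lower_unitriangular M" and inverse: "M \<odot> L = mat_one"
  shows "left_partial (shift L \<odot> M) n = (shift ^^ Suc n) L \<odot> M"
proof (induction n)
  case 0
  then show ?case
    by simp
next
  case (Suc n)
  let ?L = "(shift ^^ Suc n) L" and ?M = "(shift ^^ Suc n) M" and ?L' = "(shift ^^ Suc (Suc n)) L"
  note lower = lower_unitriangular_shift_power[OF L] lower_unitriangular_shift_power[OF M] M
  have cancel: "?M \<odot> ?L = mat_one"
    unfolding shift_power_mult[OF M, symmetric] inverse by (rule shift_power_mat_one)
  \<comment> \<open>The shift inside \<open>shift L\<close> raises the exponent of \<open>L\<close>
    to one more than that of \<open>M\<close>; hence \<open>?M\<close> meets the \<open>?L\<close>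
    of the previous stage.\<close>
  have "(shift ^^ Suc n) (shift L \<odot> M) = ?L' \<odot> ?M"
    by (simp only: shift_power_mult[OF lower_unitriangular_shift[OF L]])
       (simp only: funpow_Suc_right comp_apply)
  then have "left_partial (shift L \<odot> M) (Suc n) = ?L' \<odot> ?M \<odot> (?L \<odot> M)"
    using Suc by simp
  also have "\<dots> = ?L' \<odot> (?M \<odot> ?L \<odot> M)"
    by (simp add: mat_mult_assoc lower lower_unitriangular_mult del: funpow.simps)
  finally show ?case
    by (simp only: cancel mat_one_mult)
qed

text \<open>At stage \<open>n\<close> the factor in front of \<open>M\<close> carries
  \<open>n + 1\<close> shifts, so the rows \<open>i \<le> n\<close> are already those of
  \<open>M\<close>.\<close>

lemma left_iterated_shift_mult_inverse:
  fixes L M :: "'a::{ring, monoid_mult} infmat"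
  assumes "lower_unitriangular L" "lower_unitriangular M" "M \<odot> L = mat_one"
  shows "left_iterated (shift L \<odot> M) = M"
  unfolding left_iterated_def
  by (intro mat_lim_eqI)
     (simp add: left_partial_shift_mult_inverse shift_power_mult_row assms del: funpow.simps)

section \<open>The two directions\<close>

lemma LU_decomposition_imp_fundamental_sequence:
  fixes A :: "'a::{ring, monoid_mult} infmat"
  assumes "LU_decomposition A L U"
  shows "fundamental_sequence A (shift L \<odot> mat_inv L)"
proof -
  have L: "lower_unitriangular L" and U: "upper_triangular U" and A: "A = L \<odot> U"
    using assms by (simp_all add: LU_decomposition_def)
  note M = lower_unitriangular_mat_inv[OF L] mat_inv_left[OF L]
  have "left_iterated (shift L \<odot> mat_inv L) \<odot> A = U"
    by (simp add: left_iterated_shift_mult_inverse A mat_mult_assoc[symmetric] L M mat_one_mult)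
  then show ?thesis
    by (simp add: fundamental_sequence_def U lower_unitriangular_mult lower_unitriangular_shift L M)
qed

text \<open>With \<open>P = left_iterated T\<close>, the identity LP = 1 gives A = (LP)A = L(PA),
  where PA is upper triangular by hypothesis, and it identifies \<open>P\<close> as the inverse of
  \<open>L\<close>.\<close>

lemma fundamental_sequence_imp_LU_decomposition:
  fixes A T :: "'a::{ring, monoid_mult} infmat"
  assumes "fundamental_sequence A T"
  defines "L \<equiv> right_iterated (mat_inv T)"
  shows "LU_decomposition A L (left_iterated T \<odot> A)" "mat_inv L = left_iterated T"
proof -
  have T: "lower_unitriangular T" and U: "upper_triangular (left_iterated T \<odot> A)"
    using assms by (simp_all add: fundamental_sequence_def)
  note S = lower_unitriangular_mat_inv[OF T]
  have L: "lower_unitriangular L"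
    unfolding L_def by (rule lower_unitriangular_right_iterated[OF S])
  note P = lower_unitriangular_left_iterated[OF T]
  have LP: "L \<odot> left_iterated T = mat_one"
    unfolding L_def by (rule right_iterated_mult_left_iterated[OF S T mat_inv_left[OF T]])
  show "mat_inv L = left_iterated T"
    by (rule mat_inv_eqI[OF L P LP])
  show "LU_decomposition A L (left_iterated T \<odot> A)"
    by (simp add: LU_decomposition_def L U mat_mult_assoc[OF L P, symmetric] LP mat_one_mult)
qed

theorem proposition3p4:
  fixes scale :: "'k::field_char_0 \<Rightarrow> 'a::{ring, monoid_mult} \<Rightarrow> 'a"
    and A :: "'a infmat"
  assumes "unital_algebra scale"
  shows "(admits_periodic_gauss A \<longleftrightarrow> (\<exists>L U. LU_decomposition A L U))
    \<and> (\<forall>L U. LU_decomposition A L U \<longrightarrow> fundamental_sequence A (shift L \<odot> mat_inv L))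
    \<and> (\<forall>T. fundamental_sequence A T \<longrightarrow>
          (\<exists>L U. LU_decomposition A L U
             \<and> mat_inv L = left_iterated T
             \<and> L = right_iterated (mat_inv T)))"
  unfolding admits_periodic_gauss_def
  using LU_decomposition_imp_fundamental_sequence[of A]
    fundamental_sequence_imp_LU_decomposition[of A]
  by blast

end
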